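(* Let $(M,\varphi)$ be a manifold with $G_2$-structure, with associated metric $g_\varphi$ and cross product $\times_\varphi$. Let $R$ be a nowhere vanishing vector field on $M$, normalized so that $\|R\|_{g_\varphi}=1$, and let $(J_R,R,\alpha_R,g_\varphi)$ be the almost contact metric structure given by $\alpha_R(u)=g_\varphi(R,u)$ and $J_R(u)=R\times_\varphi u$. Suppose that $\xi$ is a contact structure on $M$ such that $(J_R,R,\alpha_R,g_\varphi)$ is an associated almost contact metric structure for $\xi$. Then $\xi$ is A-compatible with $\varphi$.
   Context: A $G_2$-structure on a smooth $7$-manifold $M$ is a $3$-form $\varphi$ on $M$ such that for every $p\in M$ the pair $(T_pM,\varphi_p)$ is linearly isomorphic to $(\mathbb{R}^7,\varphi_0)$, where $\varphi_0=e^{123}+e^{145}+e^{167}+e^{246}-e^{257}-e^{347}-e^{356}$ and $e^{ijk}=dx_i\wedge dx_j\wedge dx_k$. Such a $\varphi$ determines a Riemannian metric $g_\varphi$ and a volume form $\mathrm{Vol}$ on $M$ with $(\iota_u\varphi)\wedge(\iota_v\varphi)\wedge\varphi=6\,g_\varphi(u,v)\,\mathrm{Vol}$ for all vector fields $u,v$ (corresponding to the standard metric and volume form of $\mathbb{R}^7$ when $\varphi=\varphi_0$), and a cross product $\times_\varphi$ defined by $g_\varphi(u\times_\varphi v,w)=\varphi(u,v,w)$. Here $\iota$ is the interior product. A contact form on a $(2n+1)$-dimensional manifold is a $1$-form $\alpha$ with $\alpha\wedge(d\alpha)^n$ nowhere zero. A co-oriented contact structure is a hyperplane distribution $\xi=\mathrm{Ker}(\alpha)$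 for a global contact form $\alpha$; any such $\alpha$ is called a contact form for $\xi$. The Reeb vector field of a contact form $\alpha$ is the unique vector field $R$ with $\iota_R d\alpha=0$ and $\alpha(R)=1$. An almost contact structure is a triple $(J,R,\alpha)$ (an endomorphism field of the tangent bundle, a vector field, a $1$-form) with $\alpha(R)=1$ and $J^2=-I+\alpha\otimes R$; it is an almost contact metric structure $(J,R,\alpha,g)$ together with a Riemannian metric $g$ satisfying $g(Ju,Jv)=g(u,v)-\alpha(u)\alpha(v)$ for all $u,v$. Let $\alpha$ be a contact form with Reeb vector field $R$ and $\xi=\mathrm{Ker}(\alpha)$. The triple $(J,R,\alpha)$ is an associated almost contact structure for $\xi$ if $J$ is a $d\alpha$-compatible almost complex structure on $\xi$, i.e. $d\alpha(JX,JY)=d\alpha(X,Y)$ for $X,Y\in\xi$ and $d\alpha(X,JX)>0$ for nonzero $X\in\xi$. The quadruple $(J,R,\alpha,g)$, with $g$ a Riemannian metric, is an associated almost contact metric structure for $\xi$ if in addition $g(JX,JY)=g(X,Y)-\alpha(X)\alpha(Y)$ and $d\alpha(X,Y)=g(JX,Y)$ for all $X,Y\in TM$. A co-oriented contact structure $\xi$ on $(M,\varphi)$ is A-compatible with $\varphi$ if there exist a vector field $R$ on $M$ and a nowhere-zero function $f:M\to\mathbb{R}$ such that $d\alpha=\iota_R\varphi$ for some contact form $\alpha$ for $\xi$, and $fR$ is the Reeb vector field of some (possibly different) contact form for $\xi$. *)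

theory Defs
  imports "HOL-Analysis.Analysis" "HOL-Combinatorics.Permutations"
begin

section \<open>Alternating forms on a vector space\<close>

text \<open>
  A \<open>k\<close>-form on a vector space is a function on lists of vectors; only its values on lists of
  length \<open>k\<close> are meaningful. The wedge product is normalised so that
  \<open>(a \<and> b)(u, v) = a(u) b(v) - a(v) b(u)\<close> for 1-forms.
\<close>

type_synonym 'v form = "'v list \<Rightarrow> real"

definition wedge :: "nat \<Rightarrow> nat \<Rightarrow> 'v form \<Rightarrow> 'v form \<Rightarrow> 'v form" where
  "wedge k l \<omega> \<eta> = (\<lambda>vs.
     (\<Sum>\<sigma> | \<sigma> permutes {..<k + l}.
        of_int (sign \<sigma>) * \<omega> (map (\<lambda>i. vs ! \<sigma> i) [0..<k]) * \<eta> (map (\<lambda>i. vs ! \<sigma> i) [k..<k + l]))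
     / (fact k * fact l))"

text \<open>\<open>wedge_power k n \<omega>\<close> is the \<open>n\<close>-th exterior power of the \<open>k\<close>-form \<open>\<omega>\<close>, a form of degree \<open>k * n\<close>.\<close>

primrec wedge_power :: "nat \<Rightarrow> nat \<Rightarrow> 'v form \<Rightarrow> 'v form" where
  "wedge_power k 0 \<omega> = (\<lambda>_. 1)"
| "wedge_power k (Suc n) \<omega> = wedge k (k * n) \<omega> (wedge_power k n \<omega>)"

definition iprod :: "'v \<Rightarrow> 'v form \<Rightarrow> 'v form" where
  "iprod u \<omega> = (\<lambda>vs. \<omega> (u # vs))"

text \<open>\<open>dx_wedge [i, j, \<dots>]\<close> is \<open>dx\<^sub>i \<and> dx\<^sub>j \<and> \<dots>\<close>.\<close>

primrec dx_wedge :: "'n list \<Rightarrow> (real ^ 'n::finite) form" where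
  "dx_wedge [] = (\<lambda>_. 1)"
| "dx_wedge (i # js) = wedge 1 (length js) (\<lambda>vs. hd vs $ i) (dx_wedge js)"

text \<open>In the index type \<open>7\<close> the numeral \<open>7\<close> denotes the same index as \<open>0\<close>; the indices
  \<open>1, \<dots>, 7\<close> are pairwise distinct and exhaust the type.\<close>

definition phi0 :: "(real ^ 7) form" where
  "phi0 vs = dx_wedge [1,2,3] vs + dx_wedge [1,4,5] vs + dx_wedge [1,6,7] vs + dx_wedge [2,4,6] vs
     - dx_wedge [2,5,7] vs - dx_wedge [3,4,7] vs - dx_wedge [3,5,6] vs"

definition vol0 :: "(real ^ 7) form" where
  "vol0 = dx_wedge [1,2,3,4,5,6,7]"


section \<open>Smooth manifolds\<close>

text \<open>\<open>Ck_on k S f\<close> and \<open>smooth_on S f\<close> are meant for open \<open>S\<close>. As the domain is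
  finite-dimensional, it suffices to iterate directional derivatives.\<close>

primrec Ck_on :: "nat \<Rightarrow> 'b::euclidean_space set \<Rightarrow> ('b \<Rightarrow> 'c::real_normed_vector) \<Rightarrow> bool" where
  "Ck_on 0 S f \<longleftrightarrow> continuous_on S f"
| "Ck_on (Suc k) S f \<longleftrightarrow> (\<forall>x\<in>S. f differentiable (at x)) \<and>
     (\<forall>v. Ck_on k S (\<lambda>x. frechet_derivative f (at x) v))"

definition smooth_on :: "'b::euclidean_space set \<Rightarrow> ('b \<Rightarrow> 'c::real_normed_vector) \<Rightarrow> bool" where
  "smooth_on S f \<longleftrightarrow> (\<forall>k. Ck_on k S f)"

text \<open>A chart is a pair of its domain and its coordinate map (relevant on the domain only). The
  manifold is a whole Hausdorff, second countable type; its smooth structure is the one generated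
  by an atlas \<open>A\<close>, which need not be maximal.\<close>

type_synonym ('a, 'n) chart = "'a set \<times> ('a \<Rightarrow> (real, 'n) vec)"

definition chart_inv :: "('a, 'n::finite) chart \<Rightarrow> real ^ 'n \<Rightarrow> 'a" where
  "chart_inv c = inv_into (fst c) (snd c)"

definition is_chart :: "('a::topological_space, 'n::finite) chart \<Rightarrow> bool" where
  "is_chart c \<longleftrightarrow> open (fst c) \<and> open (snd c ` fst c) \<and>
     homeomorphism (fst c) (snd c ` fst c) (snd c) (chart_inv c)"

definition transition :: "('a, 'n::finite) chart \<Rightarrow> ('a, 'n) chart \<Rightarrow> real ^ 'n \<Rightarrow> real ^ 'n" where
  "transition c c' = snd c' \<circ> chart_inv c"

definition smooth_manifold ::
    "('a::{t2_space, second_countable_topology}, 'n::finite) chart set \<Rightarrow> bool" where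
  "smooth_manifold A \<longleftrightarrow> (\<forall>c\<in>A. is_chart c) \<and> (\<Union>c\<in>A. fst c) = UNIV \<and>
     (\<forall>c\<in>A. \<forall>c'\<in>A. smooth_on (snd c ` (fst c \<inter> fst c')) (transition c c'))"

definition charts_at :: "('a, 'n::finite) chart set \<Rightarrow> 'a \<Rightarrow> ('a, 'n) chart set" where
  "charts_at A p = {c \<in> A. p \<in> fst c}"

definition smooth_function :: "('a, 'n::finite) chart set \<Rightarrow> ('a \<Rightarrow> real) \<Rightarrow> bool" where
  "smooth_function A f \<longleftrightarrow> (\<forall>c\<in>A. smooth_on (snd c ` fst c) (f \<circ> chart_inv c))"


section \<open>Tangent vectors and vector fields\<close>

text \<open>A tangent vector at \<open>p\<close> assigns to every chart \<open>c\<close> around \<open>p\<close> its component vector in \<open>c\<close>,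
  subject to the usual transformation rule; it is set to 0 at all other pairs \<open>c\<close>, so that
  equality of tangent vectors is equality of functions.\<close>

type_synonym ('a, 'n) tvec = "('a, 'n) chart \<Rightarrow> (real, 'n) vec"

definition tangent_space :: "('a, 'n::finite) chart set \<Rightarrow> 'a \<Rightarrow> ('a, 'n) tvec set" where
  "tangent_space A p = {v. (\<forall>c. c \<notin> charts_at A p \<longrightarrow> v c = 0) \<and>
     (\<forall>c\<in>charts_at A p. \<forall>c'\<in>charts_at A p.
        v c' = frechet_derivative (transition c c') (at (snd c p)) (v c))}"

definition lincomb ::
    "real \<Rightarrow> ('a, 'n::finite) tvec \<Rightarrow> real \<Rightarrow> ('a, 'n) tvec \<Rightarrow> ('a, 'n) tvec" where
  "lincomb a u b v = (\<lambda>c. a *\<^sub>R u c + b *\<^sub>R v c)"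

definition zero_tvec :: "('a, 'n::finite) tvec" where
  "zero_tvec = (\<lambda>_. 0)"

text \<open>The tangent vector at \<open>p\<close> with component vector \<open>x\<close> in the chart \<open>c\<close> around \<open>p\<close>.\<close>

definition chart_vec ::
    "('a, 'n::finite) chart set \<Rightarrow> ('a, 'n) chart \<Rightarrow> 'a \<Rightarrow> real ^ 'n \<Rightarrow> ('a, 'n) tvec" where
  "chart_vec A c p x = (\<lambda>c'. if c' \<in> charts_at A p
     then frechet_derivative (transition c c') (at (snd c p)) x else 0)"

definition vector_field ::
    "('a, 'n::finite) chart set \<Rightarrow> ('a \<Rightarrow> ('a, 'n) tvec) \<Rightarrow> bool" where
  "vector_field A X \<longleftrightarrow> (\<forall>p. X p \<in> tangent_space A p) \<and>
     (\<forall>c\<in>A. smooth_on (snd c ` fst c) (\<lambda>y. X (chart_inv c y) c))"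

definition endomorphism_field ::
    "('a, 'n::finite) chart set \<Rightarrow> ('a \<Rightarrow> ('a, 'n) tvec \<Rightarrow> ('a, 'n) tvec) \<Rightarrow> bool" where
  "endomorphism_field A J \<longleftrightarrow>
     (\<forall>p. \<forall>u\<in>tangent_space A p. J p u \<in> tangent_space A p) \<and>
     (\<forall>p. \<forall>u\<in>tangent_space A p. \<forall>v\<in>tangent_space A p. \<forall>a b.
        J p (lincomb a u b v) = lincomb a (J p u) b (J p v)) \<and>
     (\<forall>c\<in>A. \<forall>x. smooth_on (snd c ` fst c)
        (\<lambda>y. J (chart_inv c y) (chart_vec A c (chart_inv c y) x) c))"


section \<open>Differential forms and Riemannian metrics\<close>

definition differential_form ::
    "('a, 'n::finite) chart set \<Rightarrow> nat \<Rightarrow> ('a \<Rightarrow> ('a, 'n) tvec form) \<Rightarrow> bool" where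
  "differential_form A k \<omega> \<longleftrightarrow>
     (\<forall>p vs. length vs = k \<longrightarrow> set vs \<subseteq> tangent_space A p \<longrightarrow>
        (\<forall>i<k. \<forall>u\<in>tangent_space A p. \<forall>v\<in>tangent_space A p. \<forall>a b.
           \<omega> p (vs[i := lincomb a u b v]) = a * \<omega> p (vs[i := u]) + b * \<omega> p (vs[i := v])) \<and>
        (\<forall>i<k. \<forall>j<k. i \<noteq> j \<longrightarrow> vs ! i = vs ! j \<longrightarrow> \<omega> p vs = 0)) \<and>
     (\<forall>c\<in>A. \<forall>xs. length xs = k \<longrightarrow> smooth_on (snd c ` fst c)
        (\<lambda>y. \<omega> (chart_inv c y) (map (chart_vec A c (chart_inv c y)) xs)))"

definition form_eq ::
    "('a, 'n::finite) chart set \<Rightarrow> nat \<Rightarrow> ('a \<Rightarrow> ('a, 'n) tvec form) \<Rightarrow> ('a \<Rightarrow> ('a, 'n) tvec form) \<Rightarrow> bool"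
  where
  "form_eq A k \<omega> \<eta> \<longleftrightarrow> (\<forall>p vs. length vs = k \<longrightarrow> set vs \<subseteq> tangent_space A p \<longrightarrow> \<omega> p vs = \<eta> p vs)"

definition nowhere_zero_form ::
    "('a, 'n::finite) chart set \<Rightarrow> nat \<Rightarrow> ('a \<Rightarrow> ('a, 'n) tvec form) \<Rightarrow> bool" where
  "nowhere_zero_form A k \<omega> \<longleftrightarrow>
     (\<forall>p. \<exists>vs. length vs = k \<and> set vs \<subseteq> tangent_space A p \<and> \<omega> p vs \<noteq> 0)"

text \<open>The exterior derivative at \<open>p\<close>, computed in some chart \<open>c\<close> around \<open>p\<close> (the result does not
  depend on \<open>c\<close>): the arguments \<open>vs\<close> are extended to vector fields with constant components in \<open>c\<close>.
  These commute, so
  \<open>d\<omega>(v\<^sub>0, \<dots>, v\<^sub>k) = \<Sum>\<^sub>i (-1)\<^sup>i D\<^bsub>v\<^sub>i\<^esub> (\<omega>(v\<^sub>0, \<dots>, v\<^sub>k without v\<^sub>i))\<close>;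
  for a 1-form, \<open>d\<alpha>(u, v) = D\<^sub>u(\<alpha>(v)) - D\<^sub>v(\<alpha>(u))\<close>.\<close>

definition ext_deriv ::
    "('a, 'n::finite) chart set \<Rightarrow> ('a \<Rightarrow> ('a, 'n) tvec form) \<Rightarrow> 'a \<Rightarrow> ('a, 'n) tvec form" where
  "ext_deriv A \<omega> p vs = (let c = (SOME c. c \<in> charts_at A p) in
     (\<Sum>i<length vs. (-1) ^ i *
        frechet_derivative
          (\<lambda>y. \<omega> (chart_inv c y)
             (map (\<lambda>v. chart_vec A c (chart_inv c y) (v c)) (take i vs @ drop (Suc i) vs)))
          (at (snd c p)) ((vs ! i) c)))"

definition riemannian_metric ::
    "('a, 'n::finite) chart set \<Rightarrow> ('a \<Rightarrow> ('a, 'n) tvec \<Rightarrow> ('a, 'n) tvec \<Rightarrow> real) \<Rightarrow> bool" where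
  "riemannian_metric A g \<longleftrightarrow>
     (\<forall>p. \<forall>u\<in>tangent_space A p. \<forall>v\<in>tangent_space A p. \<forall>w\<in>tangent_space A p. \<forall>a b.
        g p (lincomb a u b v) w = a * g p u w + b * g p v w) \<and>
     (\<forall>p. \<forall>u\<in>tangent_space A p. \<forall>v\<in>tangent_space A p. g p u v = g p v u) \<and>
     (\<forall>p. \<forall>u\<in>tangent_space A p. u \<noteq> zero_tvec \<longrightarrow> g p u u > 0) \<and>
     (\<forall>c\<in>A. \<forall>x x'. smooth_on (snd c ` fst c)
        (\<lambda>y. g (chart_inv c y) (chart_vec A c (chart_inv c y) x) (chart_vec A c (chart_inv c y) x')))"


section \<open>\<open>G\<^sub>2\<close>-structures\<close>

text \<open>A linear isomorphism from \<open>(T\<^sub>pM, \<phi>\<^sub>p)\<close> to \<open>(\<real>\<^sup>7, \<phi>\<^sub>0)\<close>.\<close>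

definition G2_frame ::
    "('a, 7) chart set \<Rightarrow> ('a \<Rightarrow> ('a, 7) tvec form) \<Rightarrow> 'a \<Rightarrow> (('a, 7) tvec \<Rightarrow> real ^ 7) \<Rightarrow> bool" where
  "G2_frame A \<phi> p L \<longleftrightarrow> bij_betw L (tangent_space A p) UNIV \<and>
     (\<forall>u\<in>tangent_space A p. \<forall>v\<in>tangent_space A p. \<forall>a b.
        L (lincomb a u b v) = a *\<^sub>R L u + b *\<^sub>R L v) \<and>
     (\<forall>vs. length vs = 3 \<longrightarrow> set vs \<subseteq> tangent_space A p \<longrightarrow> \<phi> p vs = phi0 (map L vs))"

definition G2_structure :: "('a, 7) chart set \<Rightarrow> ('a \<Rightarrow> ('a, 7) tvec form) \<Rightarrow> bool" where
  "G2_structure A \<phi> \<longleftrightarrow> differential_form A 3 \<phi> \<and> (\<forall>p. \<exists>L. G2_frame A \<phi> p L)"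

text \<open>The pair of metric and volume form determined by \<open>\<phi>\<close>. The identity alone leaves a scaling
  freedom \<open>(g, Vol) \<mapsto> (f g, f\<^sup>-\<^sup>1 Vol)\<close>, which the last clause removes: the pair corresponds to
  the standard metric and volume form of \<open>\<real>\<^sup>7\<close> under every identification of \<open>\<phi>\<^sub>p\<close> with \<open>\<phi>\<^sub>0\<close>.\<close>

definition G2_metric_volume ::
    "('a, 7) chart set \<Rightarrow> ('a \<Rightarrow> ('a, 7) tvec form) \<Rightarrow>
     ('a \<Rightarrow> ('a, 7) tvec \<Rightarrow> ('a, 7) tvec \<Rightarrow> real) \<Rightarrow> ('a \<Rightarrow> ('a, 7) tvec form) \<Rightarrow> bool" where
  "G2_metric_volume A \<phi> g vol \<longleftrightarrow>
     riemannian_metric A g \<and> differential_form A 7 vol \<and> nowhere_zero_form A 7 vol \<and>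
     (\<forall>u v. vector_field A u \<longrightarrow> vector_field A v \<longrightarrow>
        form_eq A 7
          (\<lambda>p. wedge 4 3 (wedge 2 2 (iprod (u p) (\<phi> p)) (iprod (v p) (\<phi> p))) (\<phi> p))
          (\<lambda>p vs. 6 * g p (u p) (v p) * vol p vs)) \<and>
     (\<forall>p L. G2_frame A \<phi> p L \<longrightarrow>
        (\<forall>u\<in>tangent_space A p. \<forall>v\<in>tangent_space A p. g p u v = L u \<bullet> L v) \<and>
        (\<forall>vs. length vs = 7 \<longrightarrow> set vs \<subseteq> tangent_space A p \<longrightarrow> vol p vs = vol0 (map L vs)))"

text \<open>Unique as far as values on tangent vectors are concerned; \<open>SOME\<close> rather than \<open>THE\<close> because
  metrics are total functions with arbitrary values elsewhere.\<close>

definition G2_metric ::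
    "('a, 7) chart set \<Rightarrow> ('a \<Rightarrow> ('a, 7) tvec form) \<Rightarrow> 'a \<Rightarrow> ('a, 7) tvec \<Rightarrow> ('a, 7) tvec \<Rightarrow> real" where
  "G2_metric A \<phi> = (SOME g. \<exists>vol. G2_metric_volume A \<phi> g vol)"

lemma G2_metric_volume_unique:
  assumes "G2_structure A \<phi>" "G2_metric_volume A \<phi> g vol" "G2_metric_volume A \<phi> g' vol'"
    and "u \<in> tangent_space A p" "v \<in> tangent_space A p"
    and "length vs = 7" "set vs \<subseteq> tangent_space A p"
  shows "g p u v = g' p u v" and "vol p vs = vol' p vs"
proof -
  obtain L where L: "G2_frame A \<phi> p L"
    using assms(1) unfolding G2_structure_def by blast
  have "g p u v = L u \<bullet> L v" "vol p vs = vol0 (map L vs)"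
    using assms(2) L assms(4-7) unfolding G2_metric_volume_def by simp_all
  moreover have "g' p u v = L u \<bullet> L v" "vol' p vs = vol0 (map L vs)"
    using assms(3) L assms(4-7) unfolding G2_metric_volume_def by simp_all
  ultimately show "g p u v = g' p u v" and "vol p vs = vol' p vs"
    by simp_all
qed

definition G2_cross ::
    "('a, 7) chart set \<Rightarrow> ('a \<Rightarrow> ('a, 7) tvec form) \<Rightarrow> 'a \<Rightarrow> ('a, 7) tvec \<Rightarrow> ('a, 7) tvec \<Rightarrow> ('a, 7) tvec"
  where
  "G2_cross A \<phi> p u v =
     (THE z. z \<in> tangent_space A p \<and> (\<forall>w\<in>tangent_space A p. G2_metric A \<phi> p z w = \<phi> p [u, v, w]))"


section \<open>Contact and almost contact structures\<close>

definition contact_form ::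
    "('a, 'n::finite) chart set \<Rightarrow> ('a \<Rightarrow> ('a, 'n) tvec form) \<Rightarrow> bool" where
  "contact_form A \<alpha> \<longleftrightarrow> differential_form A 1 \<alpha> \<and>
     (\<exists>n. CARD('n) = 2 * n + 1 \<and>
        nowhere_zero_form A (2 * n + 1) (\<lambda>p. wedge 1 (2 * n) (\<alpha> p) (wedge_power 2 n (ext_deriv A \<alpha> p))))"

definition ker_form ::
    "('a, 'n::finite) chart set \<Rightarrow> ('a \<Rightarrow> ('a, 'n) tvec form) \<Rightarrow> 'a \<Rightarrow> ('a, 'n) tvec set" where
  "ker_form A \<alpha> p = {u \<in> tangent_space A p. \<alpha> p [u] = 0}"

definition contact_form_for ::
    "('a, 'n::finite) chart set \<Rightarrow> ('a \<Rightarrow> ('a, 'n) tvec set) \<Rightarrow> ('a \<Rightarrow> ('a, 'n) tvec form) \<Rightarrow> bool" where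
  "contact_form_for A \<xi> \<alpha> \<longleftrightarrow> contact_form A \<alpha> \<and> \<xi> = ker_form A \<alpha>"

definition contact_structure ::
    "('a, 'n::finite) chart set \<Rightarrow> ('a \<Rightarrow> ('a, 'n) tvec set) \<Rightarrow> bool" where
  "contact_structure A \<xi> \<longleftrightarrow> (\<exists>\<alpha>. contact_form_for A \<xi> \<alpha>)"

definition reeb_field ::
    "('a, 'n::finite) chart set \<Rightarrow> ('a \<Rightarrow> ('a, 'n) tvec form) \<Rightarrow> ('a \<Rightarrow> ('a, 'n) tvec) \<Rightarrow> bool" where
  "reeb_field A \<alpha> R \<longleftrightarrow> vector_field A R \<and>
     form_eq A 1 (\<lambda>p. iprod (R p) (ext_deriv A \<alpha> p)) (\<lambda>p vs. 0) \<and> (\<forall>p. \<alpha> p [R p] = 1)"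

definition almost_contact_structure ::
    "('a, 'n::finite) chart set \<Rightarrow> ('a \<Rightarrow> ('a, 'n) tvec \<Rightarrow> ('a, 'n) tvec) \<Rightarrow>
     ('a \<Rightarrow> ('a, 'n) tvec) \<Rightarrow> ('a \<Rightarrow> ('a, 'n) tvec form) \<Rightarrow> bool" where
  "almost_contact_structure A J R \<alpha> \<longleftrightarrow>
     endomorphism_field A J \<and> vector_field A R \<and> differential_form A 1 \<alpha> \<and>
     (\<forall>p. \<alpha> p [R p] = 1) \<and>
     (\<forall>p. \<forall>u\<in>tangent_space A p. J p (J p u) = lincomb (-1) u (\<alpha> p [u]) (R p))"

definition almost_contact_metric_structure ::
    "('a, 'n::finite) chart set \<Rightarrow> ('a \<Rightarrow> ('a, 'n) tvec \<Rightarrow> ('a, 'n) tvec) \<Rightarrow>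
     ('a \<Rightarrow> ('a, 'n) tvec) \<Rightarrow> ('a \<Rightarrow> ('a, 'n) tvec form) \<Rightarrow>
     ('a \<Rightarrow> ('a, 'n) tvec \<Rightarrow> ('a, 'n) tvec \<Rightarrow> real) \<Rightarrow> bool" where
  "almost_contact_metric_structure A J R \<alpha> g \<longleftrightarrow>
     almost_contact_structure A J R \<alpha> \<and> riemannian_metric A g \<and>
     (\<forall>p. \<forall>u\<in>tangent_space A p. \<forall>v\<in>tangent_space A p.
        g p (J p u) (J p v) = g p u v - \<alpha> p [u] * \<alpha> p [v])"

definition associated_almost_contact ::
    "('a, 'n::finite) chart set \<Rightarrow> ('a \<Rightarrow> ('a, 'n) tvec set) \<Rightarrow>
     ('a \<Rightarrow> ('a, 'n) tvec \<Rightarrow> ('a, 'n) tvec) \<Rightarrow>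
     ('a \<Rightarrow> ('a, 'n) tvec) \<Rightarrow> ('a \<Rightarrow> ('a, 'n) tvec form) \<Rightarrow> bool" where
  "associated_almost_contact A \<xi> J R \<alpha> \<longleftrightarrow>
     contact_form_for A \<xi> \<alpha> \<and> reeb_field A \<alpha> R \<and> almost_contact_structure A J R \<alpha> \<and>
     (\<forall>p. \<forall>u\<in>\<xi> p. J p u \<in> \<xi> p \<and> J p (J p u) = lincomb (-1) u 0 u) \<and>
     (\<forall>p. \<forall>u\<in>\<xi> p. \<forall>v\<in>\<xi> p. ext_deriv A \<alpha> p [J p u, J p v] = ext_deriv A \<alpha> p [u, v]) \<and>
     (\<forall>p. \<forall>u\<in>\<xi> p. u \<noteq> zero_tvec \<longrightarrow> ext_deriv A \<alpha> p [u, J p u] > 0)"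

definition associated_almost_contact_metric ::
    "('a, 'n::finite) chart set \<Rightarrow> ('a \<Rightarrow> ('a, 'n) tvec set) \<Rightarrow>
     ('a \<Rightarrow> ('a, 'n) tvec \<Rightarrow> ('a, 'n) tvec) \<Rightarrow>
     ('a \<Rightarrow> ('a, 'n) tvec) \<Rightarrow> ('a \<Rightarrow> ('a, 'n) tvec form) \<Rightarrow>
     ('a \<Rightarrow> ('a, 'n) tvec \<Rightarrow> ('a, 'n) tvec \<Rightarrow> real) \<Rightarrow> bool" where
  "associated_almost_contact_metric A \<xi> J R \<alpha> g \<longleftrightarrow>
     associated_almost_contact A \<xi> J R \<alpha> \<and> almost_contact_metric_structure A J R \<alpha> g \<and>
     (\<forall>p. \<forall>u\<in>tangent_space A p. \<forall>v\<in>tangent_space A p. ext_deriv A \<alpha> p [u, v] = g p (J p u) v)"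

definition A_compatible ::
    "('a, 7) chart set \<Rightarrow> ('a \<Rightarrow> ('a, 7) tvec form) \<Rightarrow> ('a \<Rightarrow> ('a, 7) tvec set) \<Rightarrow> bool" where
  "A_compatible A \<phi> \<xi> \<longleftrightarrow> contact_structure A \<xi> \<and>
     (\<exists>R f. vector_field A R \<and> smooth_function A f \<and> (\<forall>p. f p \<noteq> 0) \<and>
        (\<exists>\<alpha>. contact_form_for A \<xi> \<alpha> \<and> form_eq A 2 (ext_deriv A \<alpha>) (\<lambda>p. iprod (R p) (\<phi> p))) \<and>
        (\<exists>\<beta>. contact_form_for A \<xi> \<beta> \<and> reeb_field A \<beta> (\<lambda>p c. f p *\<^sub>R R p c)))"

end

theory Submission
  imports Defs
begin

text \<open>
  The cross product is defined by \<open>g (R \<times> u) v = \<phi> (R, u, v)\<close>, so the condition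
  \<open>d\<alpha>\<^sub>R (u, v) = g (J\<^sub>R u) v\<close> says that \<open>d\<alpha>\<^sub>R = \<iota>\<^sub>R \<phi>\<close>. Hence \<open>R\<close> itself, \<open>f = 1\<close> and the
  contact form \<open>\<alpha>\<^sub>R\<close> (in both roles) witness A-compatibility. The only point to check is that the
  cross product exists, i.e. that linear functionals on a tangent space are represented by vectors.
  For this the nondegeneracy of the metric suffices; it is part of the assumed almost contact metric
  structure, so no explicit formula for the metric is needed.
\<close>

text \<open>The transformation rule survives because the derivative of a smooth transition map is
  linear.\<close>

lemma lincomb_in_tangent_space:
  assumes A: "smooth_manifold A"
    and u: "u \<in> tangent_space A p" and v: "v \<in> tangent_space A p"
  shows "lincomb a u b v \<in> tangent_space A p"
proof -
  have "lincomb a u b v c' = frechet_derivative (transition c c') (at (snd c p)) (lincomb a u b v c)"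
    if c: "c \<in> charts_at A p" and c': "c' \<in> charts_at A p" for c c'
  proof -
    have "smooth_on (snd c ` (fst c \<inter> fst c')) (transition c c')"
      and "snd c p \<in> snd c ` (fst c \<inter> fst c')"
      using A c c' unfolding smooth_manifold_def charts_at_def by auto
    then have "transition c c' differentiable (at (snd c p))"
      unfolding smooth_on_def by (metis Ck_on.simps(2))
    then have lin: "linear (frechet_derivative (transition c c') (at (snd c p)))"
      by (rule linear_frechet_derivative)
    have "u c' = frechet_derivative (transition c c') (at (snd c p)) (u c)"
      and "v c' = frechet_derivative (transition c c') (at (snd c p)) (v c)"
      using u v c c' unfolding tangent_space_def by blast+
    then show ?thesis
      unfolding lincomb_def linear_add[OF lin] linear_scale[OF lin] by argo
  qed
  moreover have "lincomb a u b v c = 0" if "c \<notin> charts_at A p" for c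
  proof -
    have "u c = 0" and "v c = 0"
      using u v that unfolding tangent_space_def by blast+
    then show ?thesis
      by (simp add: lincomb_def)
  qed
  ultimately show ?thesis
    unfolding tangent_space_def by blast
qed

text \<open>Riesz representation: positive definiteness makes \<open>z\<close> to
  \<open>g p z\<close> injective, and equality of finite dimensions makes it onto. \<open>L\<close>
  serves as a linear coordinate system, since the tangent space is a mere set closed under
  \<open>lincomb\<close>, while the library's linear algebra lives on types such as
  \<open>real ^ 'm\<close>.\<close>

lemma riemannian_metric_riesz:
  fixes L :: "('a::{t2_space, second_countable_topology}, 'n::finite) tvec \<Rightarrow> real ^ 'm::finite"
  assumes A: "smooth_manifold A" and g: "riemannian_metric A g"
    and L: "bij_betw L (tangent_space A p) UNIV"
    and linL: "\<And>u v a b. u \<in> tangent_space A p \<Longrightarrow> v \<in> tangent_space A p \<Longrightarrow>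
      L (lincomb a u b v) = a *\<^sub>R L u + b *\<^sub>R L v"
    and l: "\<And>u v a b. u \<in> tangent_space A p \<Longrightarrow> v \<in> tangent_space A p \<Longrightarrow>
      l (lincomb a u b v) = a * l u + b * l v"
  shows "\<exists>!z. z \<in> tangent_space A p \<and> (\<forall>w\<in>tangent_space A p. g p z w = l w)"
proof -
  let ?T = "tangent_space A p"
  have glin: "g p (lincomb a u b v) w = a * g p u w + b * g p v w"
    if "u \<in> ?T" "v \<in> ?T" "w \<in> ?T" for u v w a b
    using g that unfolding riemannian_metric_def by blast
  have gsym: "g p u v = g p v u" if "u \<in> ?T" "v \<in> ?T" for u v
    using g that unfolding riemannian_metric_def by blast
  have gpos: "g p u u > 0" if "u \<in> ?T" "u \<noteq> zero_tvec" for u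
    using g that unfolding riemannian_metric_def by blast
  have glin': "g p w (lincomb a u b v) = a * g p w u + b * g p w v"
    if "u \<in> ?T" "v \<in> ?T" "w \<in> ?T" for u v w a b
    using glin[OF that, of a b] gsym[OF that(3) lincomb_in_tangent_space[OF A that(1,2)]]
      gsym[OF that(3,1)] gsym[OF that(3,2)] that by simp
  define M where "M = inv_into ?T L"
  have MT: "M x \<in> ?T" and L_M: "L (M x) = x" for x
    using L unfolding M_def bij_betw_def
    by (simp_all add: inv_into_into f_inv_into_f)
  have M_L: "M (L u) = u" if "u \<in> ?T" for u
    using L that unfolding M_def bij_betw_def by (auto intro: inv_into_f_f)
  have Mlin: "M (a *\<^sub>R x + b *\<^sub>R y) = lincomb a (M x) b (M y)" for a b x y
    using linL[OF MT MT, of a x b y] M_L[OF lincomb_in_tangent_space[OF A MT MT], of a x b y] L_M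
    by simp
  have linear_comp: "linear (\<lambda>x. h (M x))"
    if h: "\<And>u v a b. u \<in> ?T \<Longrightarrow> v \<in> ?T \<Longrightarrow> h (lincomb a u b v) = a * h u + b * h v"
    for h :: "('a, 'n) tvec \<Rightarrow> real"
  proof (rule linearI)
    \<comment> \<open>Sums are \<open>lincomb\<close> with coefficients 1 and 1; multiples take 0 as
      second coefficient, with \<open>x\<close> as a dummy vector.\<close>
    show "h (M (x + y)) = h (M x) + h (M y)" for x y
      using Mlin[of 1 x 1 y] h[OF MT MT, of 1 x 1 y] by simp
    show "h (M (r *\<^sub>R x)) = r *\<^sub>R h (M x)" for r x
      using Mlin[of r x 0 x] h[OF MT MT, of r x 0 x] by simp
  qed
  \<comment> \<open>The vectors \<open>M (axis i 1)\<close> play the role of a basis of the tangent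
    space.\<close>
  have agree: "h w = k w"
    if "\<And>u v a b. u \<in> ?T \<Longrightarrow> v \<in> ?T \<Longrightarrow> h (lincomb a u b v) = a * h u + b * h v"
      and "\<And>u v a b. u \<in> ?T \<Longrightarrow> v \<in> ?T \<Longrightarrow> k (lincomb a u b v) = a * k u + b * k v"
      and "\<And>i. h (M (axis i 1)) = k (M (axis i 1))" and "w \<in> ?T"
    for h k :: "('a, 'n) tvec \<Rightarrow> real" and w
  proof -
    have "(\<lambda>x. h (M x)) = (\<lambda>x. k (M x))"
      by (rule linear_eq_stdbasis[OF linear_comp linear_comp])
        (use that in \<open>auto simp: Basis_vec_def\<close>)
    then show ?thesis
      using M_L[OF \<open>w \<in> ?T\<close>] by (auto dest!: fun_cong[of _ _ "L w"])
  qed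
  have unique: "z = z'"
    if "z \<in> ?T" "z' \<in> ?T" and eq: "\<And>w. w \<in> ?T \<Longrightarrow> g p z w = g p z' w" for z z'
  proof -
    \<comment> \<open>Testing the equality against the difference of the two vectors gives it
      squared length 0.\<close>
    let ?d = "lincomb 1 z (-1) z'"
    have d: "?d \<in> ?T"
      using lincomb_in_tangent_space[OF A] that by blast
    then have "g p ?d ?d = 0"
      using glin[OF that(1,2) d] eq by simp
    then have "?d = zero_tvec"
      using gpos[OF d] by force
    then show ?thesis
      by (auto simp: lincomb_def zero_tvec_def fun_eq_iff)
  qed
  \<comment> \<open>\<open>F x\<close> lists the values of the functional \<open>g p (M x)\<close>
    on that basis, so \<open>F\<close> acts as the Gram matrix of \<open>g p\<close>. Representing
    \<open>l\<close> means solving one linear system with matrix \<open>F\<close>.\<close>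
  define F :: "real ^ 'm \<Rightarrow> real ^ 'm" where "F x = (\<chi> i. g p (M x) (M (axis i 1)))" for x
  have linF: "linear F"
  proof (rule linearI)
    show "F (x + y) = F x + F y" for x y
      using linear_add[OF linear_comp[of "\<lambda>u. g p u (M (axis _ 1))", OF glin[OF _ _ MT]]]
      by (simp add: F_def vec_eq_iff)
    show "F (r *\<^sub>R x) = r *\<^sub>R F x" for r x
      using linear_scale[OF linear_comp[of "\<lambda>u. g p u (M (axis _ 1))", OF glin[OF _ _ MT]]]
      by (simp add: F_def vec_eq_iff)
  qed
  have "inj F"
  proof (rule injI)
    fix x y assume "F x = F y"
    then have "g p (M x) (M (axis i 1)) = g p (M y) (M (axis i 1))" for i
      by (simp add: F_def vec_eq_iff)
    then have "g p (M x) w = g p (M y) w" if "w \<in> ?T" for w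
      using agree[of "g p (M x)" "g p (M y)" w] glin'[OF _ _ MT] that by blast
    then have "M x = M y"
      using unique MT by blast
    from arg_cong[OF this, of L] show "x = y"
      unfolding L_M .
  qed
  then have "surj F"
    using linF linear_injective_imp_surjective by blast
  then obtain x where x: "F x = (\<chi> i. l (M (axis i 1)))"
    by (metis surjD)
  then have "g p (M x) (M (axis i 1)) = l (M (axis i 1))" for i
    by (simp add: F_def vec_eq_iff)
  then have z: "g p (M x) w = l w" if "w \<in> ?T" for w
    using agree[of "g p (M x)" l w] glin'[OF _ _ MT] l that by blast
  show ?thesis
  proof (intro ex1I conjI ballI)
    show "M x \<in> ?T" and "\<And>w. w \<in> ?T \<Longrightarrow> g p (M x) w = l w"
      using MT z by blast+
    show "z' = M x" if "z' \<in> ?T \<and> (\<forall>w\<in>?T. g p z' w = l w)" for z'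
      using unique[of z' "M x"] MT z that by simp
  qed
qed

text \<open>\<open>G2_cross\<close> is a \<open>THE\<close> term, so its characteristic equation
  requires a unique representing vector for \<open>\<phi> p [u, v, _]\<close>. The Riesz lemma
  provides it, with a \<open>G2_frame\<close> as coordinates.\<close>

lemma G2_metric_cross:
  fixes A :: "('a::{t2_space, second_countable_topology}, 7) chart set"
  assumes A: "smooth_manifold A" and \<phi>: "G2_structure A \<phi>"
    and g: "riemannian_metric A (G2_metric A \<phi>)"
    and u: "u \<in> tangent_space A p" and v: "v \<in> tangent_space A p" and w: "w \<in> tangent_space A p"
  shows "G2_metric A \<phi> p (G2_cross A \<phi> p u v) w = \<phi> p [u, v, w]"
proof -
  obtain L where "G2_frame A \<phi> p L"
    using \<phi> unfolding G2_structure_def by blast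
  then have L: "bij_betw L (tangent_space A p) UNIV"
    and linL: "\<And>x y a b. x \<in> tangent_space A p \<Longrightarrow> y \<in> tangent_space A p \<Longrightarrow>
      L (lincomb a x b y) = a *\<^sub>R L x + b *\<^sub>R L y"
    unfolding G2_frame_def by blast+
  have "\<phi> p [u, v, lincomb a x b y] = a * \<phi> p [u, v, x] + b * \<phi> p [u, v, y]"
    if x: "x \<in> tangent_space A p" and y: "y \<in> tangent_space A p" for x y a b
  proof -
    \<comment> \<open>Linearity in the last argument is the slot condition of
      \<open>differential_form\<close> at index 2, counted from 0.\<close>
    have len: "length [u, v, x] = 3" and sub: "set [u, v, x] \<subseteq> tangent_space A p" and "2 < (3::nat)"
      using u v x by auto
    then have "\<phi> p ([u, v, x][2 := lincomb a x b y])
        = a * \<phi> p ([u, v, x][2 := x]) + b * \<phi> p ([u, v, x][2 := y])"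
      using \<phi> x y unfolding G2_structure_def differential_form_def by blast
    then show ?thesis
      by (simp add: numeral_2_eq_2)
  qed
  then have "\<exists>!z. z \<in> tangent_space A p \<and>
      (\<forall>w\<in>tangent_space A p. G2_metric A \<phi> p z w = \<phi> p [u, v, w])"
    using riemannian_metric_riesz[OF A g L linL, of "\<lambda>w. \<phi> p [u, v, w]"] by blast
  from theI'[OF this] w show ?thesis
    unfolding G2_cross_def by blast
qed

lemma smooth_on_const: "smooth_on S (\<lambda>_. c)"
proof -
  have "Ck_on k S (\<lambda>_. c)" for k
    \<comment> \<open>The constant must vary: the derivative of a constant is the constant
      0.\<close>
    by (induction k arbitrary: c) simp_all
  then show ?thesis
    by (simp add: smooth_on_def)
qed

theorem theorem5p7:
  fixes A :: "('a::{t2_space, second_countable_topology}, 7) chart set"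
    and \<phi> :: "'a \<Rightarrow> ('a, 7) tvec form"
    and R :: "'a \<Rightarrow> ('a, 7) tvec"
    and J_R :: "'a \<Rightarrow> ('a, 7) tvec \<Rightarrow> ('a, 7) tvec"
    and \<alpha>_R :: "'a \<Rightarrow> ('a, 7) tvec form"
    and \<xi> :: "'a \<Rightarrow> ('a, 7) tvec set"
  assumes "smooth_manifold A"
    and "G2_structure A \<phi>"
    and "vector_field A R"
    and "\<And>p. R p \<noteq> zero_tvec"
    and "\<And>p. sqrt (G2_metric A \<phi> p (R p) (R p)) = 1"
    and "J_R = (\<lambda>p u. G2_cross A \<phi> p (R p) u)"
    and "\<alpha>_R = (\<lambda>p us. G2_metric A \<phi> p (R p) (hd us))"
    and "contact_structure A \<xi>"
    and "associated_almost_contact_metric A \<xi> J_R R \<alpha>_R (G2_metric A \<phi>)"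
  shows "A_compatible A \<phi> \<xi>"
proof -
  \<comment> \<open>That the \<open>SOME\<close> choice \<open>G2_metric\<close> is a metric is read
    off from the almost contact metric structure.\<close>
  have g: "riemannian_metric A (G2_metric A \<phi>)"
    and contact: "contact_form_for A \<xi> \<alpha>_R" and reeb: "reeb_field A \<alpha>_R R"
    and d\<alpha>: "\<And>p u v. u \<in> tangent_space A p \<Longrightarrow> v \<in> tangent_space A p \<Longrightarrow>
      ext_deriv A \<alpha>_R p [u, v] = G2_metric A \<phi> p (J_R p u) v"
    using assms(9)
    unfolding associated_almost_contact_metric_def associated_almost_contact_def
      almost_contact_metric_structure_def
    by blast+
  have "form_eq A 2 (ext_deriv A \<alpha>_R) (\<lambda>p. iprod (R p) (\<phi> p))"
    unfolding form_eq_def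
  proof (intro allI impI)
    fix p and vs :: "('a, 7) tvec list"
    assume "length vs = 2" and vs: "set vs \<subseteq> tangent_space A p"
    then obtain u v where "vs = [u, v]"
      by (auto simp: numeral_2_eq_2 length_Suc_conv)
    moreover have "R p \<in> tangent_space A p"
      using assms(3) unfolding vector_field_def by blast
    ultimately show "ext_deriv A \<alpha>_R p vs = iprod (R p) (\<phi> p) vs"
      using vs d\<alpha> G2_metric_cross[OF assms(1,2) g] by (simp add: assms(6) iprod_def)
  qed
  moreover have "smooth_function A (\<lambda>_. 1)"
    by (simp add: smooth_function_def comp_def smooth_on_const)
  \<comment> \<open>The trivial factor 1 matches the shape \<open>f p *\<^sub>R R p c\<close> in
    \<open>A_compatible\<close>.\<close>
  moreover have "reeb_field A \<alpha>_R (\<lambda>p c. 1 *\<^sub>R R p c)"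
    using reeb by simp
  ultimately show ?thesis
    unfolding A_compatible_def using assms(3,8) contact
    by (intro conjI exI[of _ R] exI[of _ "\<lambda>_. 1"] exI[of _ \<alpha>_R]) auto
qed

end
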